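(* Let $\alpha\in\mathbb R$ and let $(\phi,\psi)$ be a $q\times q$ Stieltjes pair (with respect to $\alpha$). Then there exists a discrete subset $\mathcal D$ of $\mathbb C\setminus[\alpha,\infty)$ such that $\phi$ and $\psi$ are holomorphic in $\mathbb C\setminus([\alpha,\infty)\cup\mathcal D)$ and, for all $w,z\in\mathbb C\setminus([\alpha,\infty)\cup\mathcal D)$, $\mathcal R(\phi(w))=\mathcal R(\phi(z))$, $\mathcal R(\psi(w))=\mathcal R(\psi(z))$, $\psi(w)\mathcal N(\phi(w))=\psi(z)\mathcal N(\phi(z))$, and $\phi(w)\mathcal N(\psi(w))=\phi(z)\mathcal N(\psi(z))$.
   Context: $J_q:=\begin{pmatrix}0&-iI_q\\ iI_q&0\end{pmatrix}$; $\mathcal R$, $\mathcal N$ denote column space and null space. A pair $(\phi,\psi)$ of $q\times q$ matrix-valued functions meromorphic in $\mathbb C\setminus[\alpha,\infty)$ is a $q\times q$ Stieltjes pair if there exists a discrete subset $\mathcal D$ of $\mathbb C\setminus[\alpha,\infty)$ such that: (i) $\phi,\psi$ are holomorphic in $\mathbb C\setminus([\alpha,\infty)\cup\mathcal D)$; (ii) $\operatorname{rank}\begin{pmatrix}\phi(z)\\\psi(z)\end{pmatrix}=q$ for each $z\in\mathbb C\setminus([\alpha,\infty)\cup\mathcal D)$; (iii) for each $z\in\mathbb C\setminus(\mathbb R\cup\mathcal D)$ both $\begin{pmatrix}\phi(z)\\\psi(z)\end{pmatrix}^*\frac{-J_q}{2\operatorname{Im}z}\begin{pmatrix}\phi(z)\\\psi(z)\end{pmatrix}$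 and $\begin{pmatrix}(z-\alpha)\phi(z)\\\psi(z)\end{pmatrix}^*\frac{-J_q}{2\operatorname{Im}z}\begin{pmatrix}(z-\alpha)\phi(z)\\\psi(z)\end{pmatrix}$ are positive semidefinite. *)

theory Defs
  imports "HOL-Analysis.Analysis" "HOL-Complex_Analysis.Complex_Analysis"
begin

text \<open>The domain \<open>\<complex> \ [\<alpha>,\<infinity>)\<close>.\<close>
definition slit_dom :: "real \<Rightarrow> complex set" where
  "slit_dom \<alpha> = - (complex_of_real ` {\<alpha>..})"

text \<open>Conjugate transpose.\<close>
definition adj :: "complex^'n::finite^'m::finite \<Rightarrow> complex^'m^'n" where
  "adj A = (\<chi> i j. cnj (A $ j $ i))"

text \<open>Stacked column block matrix [A; B] with rows indexed by \<open>'m + 'm\<close>.\<close>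
definition stack :: "complex^'n::finite^'m::finite \<Rightarrow> complex^'n^'m \<Rightarrow> complex^'n^('m + 'm)" where
  "stack A B = (\<chi> r. case r of Inl i \<Rightarrow> A $ i | Inr i \<Rightarrow> B $ i)"

text \<open>\<open>J_q = [[0, -i I],[i I, 0]]\<close>.\<close>
definition Jq :: "complex^('q::finite + 'q)^('q + 'q)" where
  "Jq = (\<chi> r s. case (r, s) of
           (Inl i, Inr j) \<Rightarrow> (if i = j then - \<i> else 0)
         | (Inr i, Inl j) \<Rightarrow> (if i = j then \<i> else 0)
         | _ \<Rightarrow> 0)"

text \<open>Positive semidefinite complex matrix: \<open>x* M x\<close> is real and nonnegative for all \<open>x\<close>.\<close>
definition psd :: "complex^'n::finite^'n \<Rightarrow> bool" where
  "psd M \<longleftrightarrow> (\<forall>x. let v = (\<Sum>i\<in>UNIV. cnj (x $ i) * (M *v x) $ i) in Im v = 0 \<and> Re v \<ge> 0)"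

text \<open>Matrix-valued meromorphic / holomorphic: entrywise.\<close>
definition mat_meromorphic_on :: "(complex \<Rightarrow> complex^'n^'m) \<Rightarrow> complex set \<Rightarrow> bool" where
  "mat_meromorphic_on F S \<longleftrightarrow> (\<forall>i j. (\<lambda>z. F z $ i $ j) meromorphic_on S)"

definition mat_holomorphic_on :: "(complex \<Rightarrow> complex^'n^'m) \<Rightarrow> complex set \<Rightarrow> bool" where
  "mat_holomorphic_on F S \<longleftrightarrow> (\<forall>i j. (\<lambda>z. F z $ i $ j) holomorphic_on S)"

text \<open>Discrete subset of an open set \<open>U\<close>: no accumulation point inside \<open>U\<close>.\<close>
definition discrete_subset :: "complex set \<Rightarrow> complex set \<Rightarrow> bool" where
  "discrete_subset D U \<longleftrightarrow> D \<subseteq> U \<and> D sparse_in U"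

text \<open>Scalar multiple of a matrix.\<close>
definition smat :: "complex \<Rightarrow> complex^'n::finite^'m::finite \<Rightarrow> complex^'n^'m" where
  "smat c A = (\<chi> i j. c * A $ i $ j)"

definition stieltjes_pair :: "real \<Rightarrow> (complex \<Rightarrow> complex^'q::finite^'q) \<Rightarrow> (complex \<Rightarrow> complex^'q^'q) \<Rightarrow> bool" where
  "stieltjes_pair \<alpha> \<phi> \<psi> \<longleftrightarrow>
     mat_meromorphic_on \<phi> (slit_dom \<alpha>) \<and> mat_meromorphic_on \<psi> (slit_dom \<alpha>) \<and>
     (\<exists>D. discrete_subset D (slit_dom \<alpha>) \<and>
        mat_holomorphic_on \<phi> (slit_dom \<alpha> - D) \<and> mat_holomorphic_on \<psi> (slit_dom \<alpha> - D) \<and>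
        (\<forall>z \<in> slit_dom \<alpha> - D. rank (stack (\<phi> z) (\<psi> z)) = CARD('q)) \<and>
        (\<forall>z. z \<notin> \<real> \<and> z \<notin> D \<longrightarrow>
           psd (adj (stack (\<phi> z) (\<psi> z)) ** smat (- 1 / (2 * complex_of_real (Im z))) Jq
                  ** stack (\<phi> z) (\<psi> z)) \<and>
           psd (adj (stack (smat (z - complex_of_real \<alpha>) (\<phi> z)) (\<psi> z))
                  ** smat (- 1 / (2 * complex_of_real (Im z))) Jq
                  ** stack (smat (z - complex_of_real \<alpha>) (\<phi> z)) (\<psi> z))))"

end

theory Submission
  imports Defs
begin

text \<open>Substituting \<open>z = \<alpha> + \<zeta>\<^sup>2\<close> maps the upper half-plane onto \<open>\<complex> \ [\<alpha>,\<infinity>)\<close>. There the two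
  positivity conditions of a Stieltjes pair combine to \<open>Im \<langle>\<zeta>\<phi>x, \<psi>x\<rangle> \<le> 0\<close>, first off the imaginary
  axis and then everywhere by continuity. So \<open>(\<zeta>\<phi>, \<psi>)\<close> and \<open>(\<psi>, -\<zeta>\<phi>)\<close> are holomorphic families of
  dissipative pairs \<open>(F, G)\<close> with trivial common kernel. For such a pair the Cayley transform
  \<open>C = (G + iF)(G - iF)\<^sup>-\<^sup>1\<close> is a contraction whose fixed space is \<open>G(ker F)\<close>, and \<open>ran F\<close> is the
  orthogonal complement of that space. If \<open>C(\<zeta>\<^sub>0) y = y\<close>, the holomorphic function \<open>\<langle>y, C(\<zeta>) y\<rangle>\<close> is
  bounded by \<open>|y|\<^sup>2\<close> and attains this bound at \<open>\<zeta>\<^sub>0\<close>, so by the maximum modulus principle it is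
  constant and \<open>C(\<zeta>) y = y\<close> everywhere. Hence \<open>G(ker F)\<close> and \<open>ran F\<close> do not depend on \<open>\<zeta>\<close>.\<close>

section \<open>The complex inner product on \<open>complex^'n\<close>\<close>

definition cinner :: "complex^'n::finite \<Rightarrow> complex^'n \<Rightarrow> complex" where
  "cinner u w = (\<Sum>i\<in>UNIV. cnj (u $ i) * w $ i)"

lemma cinner_commute: "cinner v u = cnj (cinner u v)"
  by (simp add: cinner_def mult.commute)

lemma cinner_add_right: "cinner y (a + b) = cinner y a + cinner y b"
  by (simp add: cinner_def sum.distrib distrib_left)

lemma cinner_scale_right: "cinner y (c *s a) = c * cinner y a"
  by (simp add: cinner_def sum_distrib_left mult.left_commute)

lemma cinner_scale_left: "cinner (c *s a) b = cnj c * cinner a b"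
  by (simp add: cinner_def sum_distrib_left mult.assoc)

lemma Re_cinner: "Re (cinner u w) = u \<bullet> w"
  by (simp add: cinner_def inner_vec_def inner_complex_def Re_sum)

lemma norm_vec_square: "(norm (x::complex^'n::finite))\<^sup>2 = (\<Sum>i\<in>UNIV. (cmod (x $ i))\<^sup>2)"
  unfolding norm_vec_def L2_set_def by (simp add: sum_nonneg)

lemma cinner_self: "cinner y y = complex_of_real ((norm y)\<^sup>2)"
  unfolding norm_vec_square cinner_def of_real_sum
  by (rule sum.cong) (auto simp: complex_norm_square[symmetric] mult.commute)

lemma norm_scale_vec: "norm (c *s (a::complex^'n::finite)) = cmod c * norm a"
  unfolding norm_vec_def by (simp add: L2_set_right_distrib norm_mult)

lemma norm_cinner_le: "cmod (cinner y a) \<le> norm y * norm a"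
proof (cases "cinner y a = 0")
  case False
  define c where "c = cnj (cinner y a) / complex_of_real (cmod (cinner y a))"
  have "cinner y (c *s a) = complex_of_real (cmod (cinner y a))"
    using False
    by (simp add: c_def cinner_scale_right field_simps complex_norm_square[symmetric] power2_eq_square[symmetric])
  then have "cmod (cinner y a) = y \<bullet> (c *s a)"
    by (metis Re_cinner Re_complex_of_real)
  also have "\<dots> \<le> norm y * norm (c *s a)"
    by (rule norm_cauchy_schwarz)
  also have "\<dots> = norm y * norm a"
    using False by (simp add: norm_scale_vec c_def norm_divide)
  finally show ?thesis .
qed simp

lemma eq_if_norm_le_Re_cinner:
  fixes a y :: "complex^'n::finite"
  assumes "norm a \<le> norm y" and "(norm y)\<^sup>2 \<le> Re (cinner y a)"
  shows "a = y"
proof -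
  have "(norm (a - y))\<^sup>2 = (norm a)\<^sup>2 - 2 * (y \<bullet> a) + (norm y)\<^sup>2"
    by (simp add: power2_norm_eq_inner inner_diff_left inner_diff_right inner_commute)
  also have "\<dots> \<le> 0"
    using assms(2) power_mono[OF assms(1) norm_ge_zero, of 2] unfolding Re_cinner by linarith
  finally show ?thesis by simp
qed

lemma norm_add_i_square_diff:
  fixes f g :: "complex^'n::finite"
  shows "(norm (g + \<i> *s f))\<^sup>2 - (norm (g - \<i> *s f))\<^sup>2 = 4 * Im (cinner f g)"
proof -
  have pointwise: "(cmod (b + \<i> * a))\<^sup>2 - (cmod (b - \<i> * a))\<^sup>2 = 4 * Im (cnj a * b)" for a b
    unfolding cmod_power2 by (simp add: algebra_simps power2_eq_square)
  show ?thesis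
    by (simp add: norm_vec_square pointwise cinner_def Im_sum sum_distrib_left flip: sum_subtractf)
qed

section \<open>Scalar multiples, stacked matrices and the form \<open>J\<^sub>q\<close>\<close>

lemma smat_mult_vector: "smat c M *v x = c *s (M *v x)"
  by (simp add: vec_eq_iff smat_def matrix_vector_mult_def sum_distrib_left mult.assoc)

lemma smat_mult_vector': "smat c M *v x = M *v (c *s x)"
  by (simp add: smat_mult_vector vec.scale)

lemma kernel_smat:
  assumes "c \<noteq> 0"
  shows "{x. smat c M *v x = 0} = {x. M *v x = 0}"
  using assms by (auto simp: smat_mult_vector vec_eq_iff)

lemma image_kernel_smat:
  assumes "c \<noteq> 0"
  shows "(*v) (smat c M) ` {x. N *v x = 0} = (*v) M ` {x. N *v x = 0}"
proof -
  have "(*v) (smat c M) ` {x. N *v x = 0} = (*v) M ` (*s) c ` {x. N *v x = 0}"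
    by (simp add: image_image smat_mult_vector')
  also have "(*s) c ` {x. N *v x = 0} = {x. N *v x = 0}"
    using assms by (auto simp: vec.scale vector_smult_assoc intro!: image_eqI[of _ _ "inverse c *s _"])
  finally show ?thesis .
qed

lemma range_smat:
  assumes "c \<noteq> 0"
  shows "range ((*v) (smat c M)) = range ((*v) M)"
  using image_kernel_smat[OF assms, of M 0] by simp

lemma subspace_range_matrix_vector_mult:
  fixes M :: "complex^'n::finite^'m::finite"
  shows "subspace (range ((*v) M))"
proof -
  have "r *\<^sub>R (M *v x) = M *v (complex_of_real r *s x)" for r x
    by (simp only: vec.scale vec_eq_iff vector_scaleR_component vector_smult_component)
       (simp add: scaleR_conv_of_real)
  then have "r *\<^sub>R y \<in> range ((*v) M)" if "y \<in> range ((*v) M)" for r y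
    using that by auto
  moreover have "y + y' \<in> range ((*v) M)" if "y \<in> range ((*v) M)" "y' \<in> range ((*v) M)" for y y'
    using that by (auto simp flip: matrix_vector_right_distrib)
  ultimately show ?thesis
    unfolding subspace_def by (metis matrix_vector_mult_0_right rangeI)
qed

lemma stack_mult_vector_Inl [simp]: "(stack A B *v x) $ Inl i = (A *v x) $ i"
  by (simp add: stack_def matrix_vector_mult_def)

lemma stack_mult_vector_Inr [simp]: "(stack A B *v x) $ Inr i = (B *v x) $ i"
  by (simp add: stack_def matrix_vector_mult_def)

lemma stack_full_rank_kernel:
  fixes A B :: "complex^'n::finite^'m::finite"
  assumes "rank (stack A B) = CARD('n)" and "A *v x = 0" and "B *v x = 0"
  shows "x = 0"
proof -
  have "stack A B *v x = 0"
    using assms(2,3) unfolding vec_eq_iff by (metis stack_mult_vector_Inl stack_mult_vector_Inr sum.exhaust zero_index)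
  moreover have "vec.span (rows (stack A B)) = UNIV"
    using assms(1) vec.dim_eq_full[of "rows (stack A B)"]
    by (simp add: row_rank_def_gen vec.dimension_def card_cart_basis)
  ultimately show ?thesis
    using matrix_left_invertible_span_rows_gen matrix_left_invertible_ker by blast
qed

lemma sum_UNIV_Plus: "sum f (UNIV :: ('a::finite + 'b::finite) set) = sum (f \<circ> Inl) UNIV + sum (f \<circ> Inr) UNIV"
  by (metis UNIV_Plus_UNIV finite sum.Plus)

lemma smat_Jq_mult_vector:
  "(smat c Jq *v y) $ Inl i = - \<i> * c * y $ Inr i"
  "(smat c Jq *v y) $ Inr i = \<i> * c * y $ Inl i"
  by (simp_all add: matrix_vector_mult_def smat_def Jq_def sum_UNIV_Plus if_distrib if_distribR cong: if_cong)

lemma cinner_stack_Jq: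
  "cinner (stack A B *v x) (smat c Jq *v (stack A B *v x))
     = c * (\<i> * cinner (B *v x) (A *v x) - \<i> * cinner (A *v x) (B *v x))"
  by (simp add: cinner_def sum_UNIV_Plus smat_Jq_mult_vector sum_distrib_left algebra_simps sum_subtractf sum_negf)

lemma cinner_adj_mult:
  fixes P :: "complex^'n::finite^'m::finite" and N :: "complex^'m^'m"
  shows "cinner x ((adj P ** N ** P) *v x) = cinner (P *v x) (N *v (P *v x))"
proof -
  define w where "w = N *v (P *v x)"
  have "(adj P ** N ** P) *v x = adj P *v w"
    by (simp add: w_def matrix_vector_mul_assoc matrix_mul_assoc)
  then have "cinner x ((adj P ** N ** P) *v x) = (\<Sum>i\<in>UNIV. \<Sum>r\<in>UNIV. cnj (x $ i) * cnj (P $ r $ i) * w $ r)"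
    by (simp add: cinner_def matrix_vector_mult_def adj_def sum_distrib_left mult.assoc)
  also have "\<dots> = cinner (P *v x) w"
    by (subst sum.swap) (simp add: cinner_def matrix_vector_mult_def sum_distrib_left sum_distrib_right mult_ac)
  finally show ?thesis by (simp add: w_def)
qed

lemma psd_Jq_stack_Im_le:
  fixes A B :: "complex^'n::finite^'q::finite"
  assumes "psd (adj (stack A B) ** smat (- 1 / (2 * complex_of_real t)) Jq ** stack A B)"
  shows "t * Im (cinner (A *v x) (B *v x)) \<le> 0"
proof -
  have "0 \<le> Re (cinner x ((adj (stack A B) ** smat (- 1 / (2 * complex_of_real t)) Jq ** stack A B) *v x))"
    using assms by (simp add: psd_def cinner_def Let_def)
  also have "\<dots> = - Im (cinner (A *v x) (B *v x)) / t"
    by (simp add: cinner_adj_mult cinner_stack_Jq cinner_commute[of "B *v x"] Re_divide power2_eq_square)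
  finally show ?thesis
    by (cases t "0::real" rule: linorder_cases) (auto simp: divide_le_0_iff zero_le_divide_iff mult_le_0_iff)
qed

lemma orthogonal_range_iff_cinner:
  fixes F :: "complex^'n::finite^'m::finite"
  shows "y \<in> (range ((*v) F))\<^sup>\<bottom> \<longleftrightarrow> (\<forall>x. cinner (F *v x) y = 0)"
proof
  assume "y \<in> (range ((*v) F))\<^sup>\<bottom>"
  then have Re_zero: "Re (cinner (F *v x) y) = 0" for x
    by (simp add: orthogonal_comp_def orthogonal_def Re_cinner)
  show "\<forall>x. cinner (F *v x) y = 0"
  proof
    fix x
    have "Im (cinner (F *v x) y) = Re (cinner (F *v (\<i> *s x)) y)"
      by (simp add: vec.scale cinner_scale_left)
    then show "cinner (F *v x) y = 0"
      using Re_zero by (simp add: complex_eq_iff)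
  qed
qed (simp add: orthogonal_comp_def orthogonal_def flip: Re_cinner)

section \<open>Dissipative pairs and their Cayley transform\<close>

definition dissipative_pair :: "complex^'n::finite^'m::finite \<Rightarrow> complex^'n^'m \<Rightarrow> bool" where
  "dissipative_pair F G \<longleftrightarrow>
     (\<forall>x. Im (cinner (F *v x) (G *v x)) \<le> 0) \<and> (\<forall>x. F *v x = 0 \<longrightarrow> G *v x = 0 \<longrightarrow> x = 0)"

lemma cayley_fixed_iff:
  "(G + smat \<i> F) *v u = y \<and> (G - smat \<i> F) *v u = y \<longleftrightarrow> F *v u = 0 \<and> G *v u = y"
proof -
  have "(2 * \<i>) *s (F *v u) = (G + smat \<i> F) *v u - (G - smat \<i> F) *v u"
    by (simp add: vec_eq_iff smat_mult_vector algebra_simps)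
  then show ?thesis
    by (auto simp: algebra_simps smat_mult_vector vec_eq_iff)
qed

lemma dissipative_pair_cayley_norm_le:
  assumes "dissipative_pair F G"
  shows "norm ((G + smat \<i> F) *v x) \<le> norm ((G - smat \<i> F) *v x)"
proof -
  have "(norm ((G + smat \<i> F) *v x))\<^sup>2 - (norm ((G - smat \<i> F) *v x))\<^sup>2 = 4 * Im (cinner (F *v x) (G *v x))"
    by (simp add: algebra_simps smat_mult_vector norm_add_i_square_diff)
  then show ?thesis
    using assms unfolding dissipative_pair_def by (smt (verit) norm_ge_zero power2_le_imp_le)
qed

lemma dissipative_pair_cayley_det_nz:
  fixes F G :: "complex^'n::finite^'n"
  assumes "dissipative_pair F G"
  shows "det (G - smat \<i> F) \<noteq> 0"
proof -
  have "x = 0" if "(G - smat \<i> F) *v x = 0" for x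
  proof -
    have "(G + smat \<i> F) *v x = 0"
      using that dissipative_pair_cayley_norm_le[OF assms, of x] by simp
    then show ?thesis
      using that assms cayley_fixed_iff[of G F x 0] unfolding dissipative_pair_def by blast
  qed
  then obtain C where "C ** (G - smat \<i> F) = mat 1"
    using matrix_left_invertible_ker by blast
  then show ?thesis
    by (metis invertible_def invertible_det_nz matrix_left_right_inverse)
qed

lemma Im_affine_le_0_imp_zero:
  fixes b c :: complex
  assumes "\<And>t. Im (c + t * b) \<le> 0"
  shows "b = 0"
proof (rule ccontr)
  assume "b \<noteq> 0"
  define s where "s = (\<bar>Im c\<bar> + 1) / (cmod b)\<^sup>2"
  have "Im (c + \<i> * cnj b * complex_of_real s * b) = Im c + s * (cmod b)\<^sup>2"
    unfolding cmod_power2 by (simp add: power2_eq_square algebra_simps)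
  also have "\<dots> = Im c + \<bar>Im c\<bar> + 1"
    using \<open>b \<noteq> 0\<close> by (simp add: s_def)
  finally show False
    using assms[of "\<i> * cnj b * complex_of_real s"] by linarith
qed

lemma dissipative_pair_orthogonal_range:
  fixes F G :: "complex^'n::finite^'n"
  assumes "dissipative_pair F G"
  shows "(range ((*v) F))\<^sup>\<bottom> = (*v) G ` {x. F *v x = 0}"
proof (intro set_eqI iffI)
  fix y
  assume "y \<in> (range ((*v) F))\<^sup>\<bottom>"
  then have orth: "cinner (F *v x) y = 0" for x
    by (simp add: orthogonal_range_iff_cinner)
  obtain u where Bu: "(G - smat \<i> F) *v u = y"
    using cramer[OF dissipative_pair_cayley_det_nz[OF assms]] by blast
  have "(G + smat \<i> F) *v u = (G - smat \<i> F) *v u + (2 * \<i>) *s (F *v u)"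
    by (simp add: vec_eq_iff smat_mult_vector algebra_simps)
  moreover have "cinner y (F *v u) = 0"
    using orth[of u] cinner_commute[of "F *v u" y] by simp
  ultimately have "cinner y ((G + smat \<i> F) *v u) = cinner y y"
    using Bu by (simp add: cinner_add_right cinner_scale_right)
  then have "(G + smat \<i> F) *v u = y"
    using Bu dissipative_pair_cayley_norm_le[OF assms, of u]
    by (intro eq_if_norm_le_Re_cinner) (simp_all add: cinner_self)
  with Bu show "y \<in> (*v) G ` {x. F *v x = 0}"
    using cayley_fixed_iff by blast
next
  fix y
  assume "y \<in> (*v) G ` {x. F *v x = 0}"
  then obtain u where u: "F *v u = 0" "y = G *v u"
    by blast
  have "cinner (F *v x) y = 0" for x
  proof (rule Im_affine_le_0_imp_zero)
    fix t
    have "Im (cinner (F *v (x + t *s u)) (G *v (x + t *s u))) \<le> 0"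
      using assms by (simp add: dissipative_pair_def)
    then show "Im (cinner (F *v x) (G *v x) + t * cinner (F *v x) y) \<le> 0"
      using u by (simp add: matrix_vector_right_distrib vec.scale cinner_add_right cinner_scale_right)
  qed
  then show "y \<in> (range ((*v) F))\<^sup>\<bottom>"
    by (simp add: orthogonal_range_iff_cinner)
qed

lemma dissipative_pair_range_eq:
  fixes F G :: "complex^'n::finite^'n"
  assumes "dissipative_pair F G"
  shows "range ((*v) F) = ((*v) G ` {x. F *v x = 0})\<^sup>\<bottom>"
  by (metis assms dissipative_pair_orthogonal_range orthogonal_comp_self subspace_range_matrix_vector_mult)

section \<open>Holomorphic families of dissipative pairs\<close>

lemma mat_holomorphic_on_cayley:
  assumes "mat_holomorphic_on F V" and "mat_holomorphic_on G V"
  shows "mat_holomorphic_on (\<lambda>\<zeta>. G \<zeta> + smat \<i> (F \<zeta>)) V"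
    and "mat_holomorphic_on (\<lambda>\<zeta>. G \<zeta> - smat \<i> (F \<zeta>)) V"
  using assms unfolding mat_holomorphic_on_def smat_def by (auto intro!: holomorphic_intros)

lemma holomorphic_on_det:
  assumes "mat_holomorphic_on M V"
  shows "(\<lambda>\<zeta>. det (M \<zeta>)) holomorphic_on V"
  using assms unfolding mat_holomorphic_on_def det_def by (intro holomorphic_intros) auto

lemma mat_holomorphic_on_smat:
  assumes "f holomorphic_on V" and "mat_holomorphic_on M V"
  shows "mat_holomorphic_on (\<lambda>\<zeta>. smat (f \<zeta>) (M \<zeta>)) V"
  using assms unfolding mat_holomorphic_on_def smat_def by (auto intro!: holomorphic_intros)

lemma mat_holomorphic_on_compose:
  assumes "mat_holomorphic_on M S" and "g holomorphic_on V" and "g ` V \<subseteq> S"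
  shows "mat_holomorphic_on (\<lambda>\<zeta>. M (g \<zeta>)) V"
  using assms holomorphic_on_compose_gen[of g V "\<lambda>z. M z $ _ $ _" S]
  unfolding mat_holomorphic_on_def by (simp add: o_def)

lemma continuous_on_cinner_mult_vector:
  fixes \<Phi> \<Psi> :: "complex \<Rightarrow> complex^'n::finite^'m::finite"
  assumes "mat_holomorphic_on \<Phi> V" and "mat_holomorphic_on \<Psi> V"
  shows "continuous_on V (\<lambda>\<zeta>. cinner (\<Phi> \<zeta> *v x) (\<Psi> \<zeta> *v x))"
proof -
  have "continuous_on V (\<lambda>\<zeta>. \<Phi> \<zeta> $ i $ j)" "continuous_on V (\<lambda>\<zeta>. \<Psi> \<zeta> $ i $ j)" for i j
    using assms by (auto simp: mat_holomorphic_on_def intro: holomorphic_on_imp_continuous_on)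
  then show ?thesis
    unfolding cinner_def matrix_vector_mult_def vec_lambda_beta
    by (intro continuous_on_sum continuous_on_mult continuous_on_cnj continuous_on_const)
qed

lemma mat_holomorphic_on_solve:
  fixes B :: "complex \<Rightarrow> complex^'n::finite^'n"
  assumes hol: "mat_holomorphic_on B V" and det: "\<And>\<zeta>. \<zeta> \<in> V \<Longrightarrow> det (B \<zeta>) \<noteq> 0"
  obtains v :: "complex \<Rightarrow> complex^'n" where "\<And>k. (\<lambda>\<zeta>. v \<zeta> $ k) holomorphic_on V" and "\<And>\<zeta>. \<zeta> \<in> V \<Longrightarrow> B \<zeta> *v v \<zeta> = y"
proof
  define v where "v \<zeta> = (\<chi> k. det (\<chi> i j. if j = k then y $ i else B \<zeta> $ i $ j) / det (B \<zeta>))" for \<zeta>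
  show "B \<zeta> *v v \<zeta> = y" if "\<zeta> \<in> V" for \<zeta>
    using cramer[OF det[OF that]] unfolding v_def by blast
  have "(\<lambda>\<zeta>. if j = k then y $ i else B \<zeta> $ i $ j) holomorphic_on V" for i j k
    using hol by (cases "j = k") (simp_all add: mat_holomorphic_on_def)
  then have "mat_holomorphic_on (\<lambda>\<zeta>. \<chi> i j. if j = k then y $ i else B \<zeta> $ i $ j) V" for k
    by (simp add: mat_holomorphic_on_def)
  then show "(\<lambda>\<zeta>. v \<zeta> $ k) holomorphic_on V" for k
    unfolding v_def using det by (auto intro!: holomorphic_intros holomorphic_on_det hol)
qed

lemma holomorphic_on_mult_vector:
  fixes A :: "complex \<Rightarrow> complex^'n::finite^'m::finite" and v :: "complex \<Rightarrow> complex^'n"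
  assumes "mat_holomorphic_on A V" and "\<And>k. (\<lambda>\<zeta>. v \<zeta> $ k) holomorphic_on V"
  shows "(\<lambda>\<zeta>. (A \<zeta> *v v \<zeta>) $ i) holomorphic_on V"
  using assms unfolding mat_holomorphic_on_def matrix_vector_mult_def by (auto intro!: holomorphic_intros)

lemma holomorphic_vector_eq_if_norm_le:
  fixes a :: "complex \<Rightarrow> complex^'n::finite"
  assumes V: "open V" "connected V" and hol: "\<And>k. (\<lambda>\<zeta>. a \<zeta> $ k) holomorphic_on V"
    and le: "\<And>\<zeta>. \<zeta> \<in> V \<Longrightarrow> norm (a \<zeta>) \<le> norm y" and "w \<in> V" "a w = y" and "z \<in> V"
  shows "a z = y"
proof -
  define h where "h \<zeta> = cinner y (a \<zeta>)" for \<zeta>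
  have "h holomorphic_on V"
    unfolding h_def cinner_def using hol by (intro holomorphic_intros)
  moreover have h_w: "h w = complex_of_real ((norm y)\<^sup>2)"
    unfolding h_def \<open>a w = y\<close> by (rule cinner_self)
  moreover have "cmod (h \<zeta>) \<le> cmod (h w)" if "\<zeta> \<in> V" for \<zeta>
  proof -
    have "cmod (h \<zeta>) \<le> norm y * norm (a \<zeta>)"
      unfolding h_def by (rule norm_cinner_le)
    also have "\<dots> \<le> (norm y)\<^sup>2"
      using le[OF that] by (simp add: power2_eq_square mult_left_mono)
    finally show ?thesis
      using h_w by (simp only: norm_of_real abs_power2 abs_norm_cancel)
  qed
  ultimately have "h constant_on V"
    using maximum_modulus_principle[OF _ V V(1) subset_refl \<open>w \<in> V\<close>] by blast
  then have "h z = h w"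
    using \<open>w \<in> V\<close> \<open>z \<in> V\<close> unfolding constant_on_def by force
  then show "a z = y"
    using h_w le[OF \<open>z \<in> V\<close>] by (intro eq_if_norm_le_Re_cinner) (simp_all add: h_def)
qed

lemma dissipative_family_image_kernel_subset:
  fixes F G :: "complex \<Rightarrow> complex^'n::finite^'n"
  assumes V: "open V" "connected V" and hol: "mat_holomorphic_on F V" "mat_holomorphic_on G V"
    and diss: "\<And>\<zeta>. \<zeta> \<in> V \<Longrightarrow> dissipative_pair (F \<zeta>) (G \<zeta>)" and "w \<in> V" "z \<in> V"
  shows "(*v) (G w) ` {x. F w *v x = 0} \<subseteq> (*v) (G z) ` {x. F z *v x = 0}"
proof
  fix y
  assume "y \<in> (*v) (G w) ` {x. F w *v x = 0}"
  define A where "A \<zeta> = G \<zeta> + smat \<i> (F \<zeta>)" for \<zeta>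
  define B where "B \<zeta> = G \<zeta> - smat \<i> (F \<zeta>)" for \<zeta>
  have det: "det (B \<zeta>) \<noteq> 0" and norm_le: "norm (A \<zeta> *v x) \<le> norm (B \<zeta> *v x)" if "\<zeta> \<in> V" for \<zeta> x
    using diss[OF that] dissipative_pair_cayley_det_nz dissipative_pair_cayley_norm_le
    unfolding A_def B_def by blast+
  obtain u where u: "A w *v u = y" "B w *v u = y"
    using \<open>y \<in> _\<close> cayley_fixed_iff unfolding A_def B_def by blast
  obtain v :: "complex \<Rightarrow> complex^'n" where hol_v: "\<And>k. (\<lambda>\<zeta>. v \<zeta> $ k) holomorphic_on V"
    and Bv: "\<And>\<zeta>. \<zeta> \<in> V \<Longrightarrow> B \<zeta> *v v \<zeta> = y"
    using mat_holomorphic_on_solve[of B, OF _ det] mat_holomorphic_on_cayley(2)[OF hol]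
    unfolding B_def by blast
  have "v w = u"
    using cramer[OF det[OF \<open>w \<in> V\<close>], of "v w" y] cramer[OF det[OF \<open>w \<in> V\<close>], of u y]
      Bv[OF \<open>w \<in> V\<close>] u(2) by simp
  have "A z *v v z = y"
  proof (rule holomorphic_vector_eq_if_norm_le[OF V _ _ \<open>w \<in> V\<close> _ \<open>z \<in> V\<close>])
    show "(\<lambda>\<zeta>. (A \<zeta> *v v \<zeta>) $ k) holomorphic_on V" for k
      unfolding A_def by (intro holomorphic_on_mult_vector mat_holomorphic_on_cayley hol hol_v)
    show "norm (A \<zeta> *v v \<zeta>) \<le> norm y" if "\<zeta> \<in> V" for \<zeta>
      using norm_le[OF that, of "v \<zeta>"] unfolding Bv[OF that] .
    show "A w *v v w = y"
      using \<open>v w = u\<close> u(1) by simp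
  qed
  then show "y \<in> (*v) (G z) ` {x. F z *v x = 0}"
    using Bv[OF \<open>z \<in> V\<close>] cayley_fixed_iff unfolding A_def B_def by blast
qed

lemma dissipative_family_const:
  fixes F G :: "complex \<Rightarrow> complex^'n::finite^'n"
  assumes "open V" "connected V" "mat_holomorphic_on F V" "mat_holomorphic_on G V"
    and "\<And>\<zeta>. \<zeta> \<in> V \<Longrightarrow> dissipative_pair (F \<zeta>) (G \<zeta>)" and "w \<in> V" "z \<in> V"
  shows "(*v) (G w) ` {x. F w *v x = 0} = (*v) (G z) ` {x. F z *v x = 0}"
    and "range ((*v) (F w)) = range ((*v) (F z))"
proof -
  show kernel_image: "(*v) (G w) ` {x. F w *v x = 0} = (*v) (G z) ` {x. F z *v x = 0}"
    using dissipative_family_image_kernel_subset[OF assms(1-5)] assms(6,7) by (intro equalityI)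
  show "range ((*v) (F w)) = range ((*v) (F z))"
    using dissipative_pair_range_eq assms(5-7) kernel_image by metis
qed

definition pair_subspaces ::
  "complex^'n::finite^'m::finite \<Rightarrow> complex^'n^'m \<Rightarrow> (complex^'m) set \<times> (complex^'m) set \<times> (complex^'m) set \<times> (complex^'m) set"
where
  "pair_subspaces A B =
     (range ((*v) A), range ((*v) B), (*v) B ` {x. A *v x = 0}, (*v) A ` {x. B *v x = 0})"

text \<open>Both \<open>(\<zeta>\<Phi>, \<Psi>)\<close> and \<open>(\<Psi>, -\<zeta>\<Phi>)\<close> are dissipative; the scalar factors do not change the four
  subspaces.\<close>
lemma holomorphic_pair_subspaces_const:
  fixes \<Phi> \<Psi> :: "complex \<Rightarrow> complex^'n::finite^'n"
  assumes V: "open V" "connected V" "0 \<notin> V"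
    and hol: "mat_holomorphic_on \<Phi> V" "mat_holomorphic_on \<Psi> V"
    and ker: "\<And>\<zeta> x. \<zeta> \<in> V \<Longrightarrow> \<Phi> \<zeta> *v x = 0 \<Longrightarrow> \<Psi> \<zeta> *v x = 0 \<Longrightarrow> x = 0"
    and Im_le: "\<And>\<zeta> x. \<zeta> \<in> V \<Longrightarrow> Im (cnj \<zeta> * cinner (\<Phi> \<zeta> *v x) (\<Psi> \<zeta> *v x)) \<le> 0"
    and "w \<in> V" "z \<in> V"
  shows "pair_subspaces (\<Phi> w) (\<Psi> w) = pair_subspaces (\<Phi> z) (\<Psi> z)"
proof -
  have nz: "\<zeta> \<noteq> 0" "- \<zeta> \<noteq> 0" if "\<zeta> \<in> V" for \<zeta>
    using that V(3) by auto
  have hol_smat: "mat_holomorphic_on (\<lambda>\<zeta>. smat \<zeta> (\<Phi> \<zeta>)) V" "mat_holomorphic_on (\<lambda>\<zeta>. smat (- \<zeta>) (\<Phi> \<zeta>)) V"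
    by (intro mat_holomorphic_on_smat hol holomorphic_intros)+
  have "dissipative_pair (smat \<zeta> (\<Phi> \<zeta>)) (\<Psi> \<zeta>)" if "\<zeta> \<in> V" for \<zeta>
    using Im_le[OF that] ker[OF that] nz[OF that]
    by (simp add: dissipative_pair_def smat_mult_vector cinner_scale_left)
  then have "range ((*v) (smat w (\<Phi> w))) = range ((*v) (smat z (\<Phi> z)))"
    and "(*v) (\<Psi> w) ` {x. smat w (\<Phi> w) *v x = 0} = (*v) (\<Psi> z) ` {x. smat z (\<Phi> z) *v x = 0}"
    using dissipative_family_const[OF V(1,2) hol_smat(1) hol(2) _ \<open>w \<in> V\<close> \<open>z \<in> V\<close>] by blast+
  then have ran_\<Phi>: "range ((*v) (\<Phi> w)) = range ((*v) (\<Phi> z))"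
    and \<Psi>_ker_\<Phi>: "(*v) (\<Psi> w) ` {x. \<Phi> w *v x = 0} = (*v) (\<Psi> z) ` {x. \<Phi> z *v x = 0}"
    using nz \<open>w \<in> V\<close> \<open>z \<in> V\<close> by (simp_all add: range_smat kernel_smat)
  have "Im (cinner (\<Psi> \<zeta> *v x) (smat (- \<zeta>) (\<Phi> \<zeta>) *v x)) = Im (cnj \<zeta> * cinner (\<Phi> \<zeta> *v x) (\<Psi> \<zeta> *v x))"
    for \<zeta> x
    by (simp only: smat_mult_vector cinner_scale_right cinner_commute[of "\<Psi> \<zeta> *v x" "\<Phi> \<zeta> *v x"]) simp
  then have "dissipative_pair (\<Psi> \<zeta>) (smat (- \<zeta>) (\<Phi> \<zeta>))" if "\<zeta> \<in> V" for \<zeta>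
    using Im_le[OF that] ker[OF that] nz[OF that]
    by (simp add: dissipative_pair_def smat_mult_vector del: vector_smult_lneg)
  then have "range ((*v) (\<Psi> w)) = range ((*v) (\<Psi> z))"
    and "(*v) (smat (- w) (\<Phi> w)) ` {x. \<Psi> w *v x = 0} = (*v) (smat (- z) (\<Phi> z)) ` {x. \<Psi> z *v x = 0}"
    using dissipative_family_const[OF V(1,2) hol(2) hol_smat(2) _ \<open>w \<in> V\<close> \<open>z \<in> V\<close>] by blast+
  then have ran_\<Psi>: "range ((*v) (\<Psi> w)) = range ((*v) (\<Psi> z))"
    and \<Phi>_ker_\<Psi>: "(*v) (\<Phi> w) ` {x. \<Psi> w *v x = 0} = (*v) (\<Phi> z) ` {x. \<Psi> z *v x = 0}"
    using nz \<open>w \<in> V\<close> \<open>z \<in> V\<close> by (simp_all add: image_kernel_smat)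
  show ?thesis
    using ran_\<Phi> ran_\<Psi> \<Phi>_ker_\<Psi> \<Psi>_ker_\<Phi> by (simp add: pair_subspaces_def)
qed

section \<open>Stieltjes pairs\<close>

lemma slit_dom_iff: "z \<in> slit_dom \<alpha> \<longleftrightarrow> Im z \<noteq> 0 \<or> Re z < \<alpha>"
proof -
  have "z \<in> complex_of_real ` {\<alpha>..} \<longleftrightarrow> Im z = 0 \<and> \<alpha> \<le> Re z"
    by (auto simp: image_iff complex_eq_iff intro!: bexI[of _ "Re z"])
  then show ?thesis
    unfolding slit_dom_def by auto
qed

lemma open_slit_dom: "open (slit_dom \<alpha>)"
proof -
  have "slit_dom \<alpha> = {z. Im z \<noteq> 0} \<union> {z. Re z < \<alpha>}"
    by (auto simp: slit_dom_iff)
  then show ?thesis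
    by (simp add: open_Un open_halfspace_Re_lt open_Collect_neq continuous_on_Im continuous_on_const)
qed

lemma shifted_square_in_slit_dom:
  assumes "0 < Im \<zeta>"
  shows "complex_of_real \<alpha> + \<zeta>\<^sup>2 \<in> slit_dom \<alpha>"
  using assms by (cases "Re \<zeta> = 0") (auto simp: slit_dom_iff power2_eq_square)

lemma shifted_square_surj:
  assumes "w \<in> slit_dom \<alpha>"
  obtains \<zeta> where "0 < Im \<zeta>" and "complex_of_real \<alpha> + \<zeta>\<^sup>2 = w"
proof
  define u where "u = complex_of_real \<alpha> - w"
  show "complex_of_real \<alpha> + (\<i> * csqrt u)\<^sup>2 = w"
    by (simp add: u_def power_mult_distrib)
  have "Re (csqrt u) \<noteq> 0"
  proof
    assume "Re (csqrt u) = 0"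
    then have "Im ((csqrt u)\<^sup>2) = 0" "Re ((csqrt u)\<^sup>2) \<le> 0"
      by (simp_all add: power2_eq_square)
    then have "Im u = 0" "Re u \<le> 0"
      by simp_all
    with assms show False
      by (simp add: u_def slit_dom_iff)
  qed
  then show "0 < Im (\<i> * csqrt u)"
    using csqrt_principal[of u] by auto
qed

lemma open_connected_shifted_square_preimage:
  assumes "discrete_subset D (slit_dom \<alpha>)"
  shows "open {\<zeta>. 0 < Im \<zeta> \<and> complex_of_real \<alpha> + \<zeta>\<^sup>2 \<notin> D}"
    and "connected {\<zeta>. 0 < Im \<zeta> \<and> complex_of_real \<alpha> + \<zeta>\<^sup>2 \<notin> D}"
proof -
  define g where "g \<zeta> = complex_of_real \<alpha> + \<zeta>\<^sup>2" for \<zeta>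
  have D: "D \<subseteq> slit_dom \<alpha>" "D sparse_in slit_dom \<alpha>"
    using assms by (auto simp: discrete_subset_def)
  have "{\<zeta>. 0 < Im \<zeta> \<and> g \<zeta> \<notin> D} = {\<zeta>. 0 < Im \<zeta>} \<inter> g -` (slit_dom \<alpha> - D)"
    using shifted_square_in_slit_dom by (auto simp: g_def)
  moreover have "open (g -` (slit_dom \<alpha> - D))"
    by (rule continuous_open_vimage[OF open_diff_sparse_pts[OF open_slit_dom D(2)]])
       (auto simp: g_def[abs_def] intro!: continuous_intros)
  ultimately show "open {\<zeta>. 0 < Im \<zeta> \<and> complex_of_real \<alpha> + \<zeta>\<^sup>2 \<notin> D}"
    by (simp add: g_def open_Int open_halfspace_Im_gt)
  have "countable D"
    using sparse_imp_countable[OF open_slit_dom D(2)] D(1) by (simp add: Int_absorb1)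
  moreover have "g -` D \<subseteq> (\<lambda>d. csqrt (d - complex_of_real \<alpha>)) ` D \<union> (\<lambda>d. - csqrt (d - complex_of_real \<alpha>)) ` D"
  proof
    fix \<zeta>
    assume "\<zeta> \<in> g -` D"
    moreover have "\<zeta>\<^sup>2 = (csqrt (g \<zeta> - complex_of_real \<alpha>))\<^sup>2"
      by (simp add: g_def)
    ultimately show "\<zeta> \<in> (\<lambda>d. csqrt (d - complex_of_real \<alpha>)) ` D \<union> (\<lambda>d. - csqrt (d - complex_of_real \<alpha>)) ` D"
      using power2_eq_iff by blast
  qed
  ultimately have "countable (g -` D)"
    by (meson countable_Un countable_image countable_subset)
  then have "connected ({\<zeta>. 0 < Im \<zeta>} - g -` D)"
    by (intro connected_open_diff_countable convex_connected convex_halfspace_Im_gt open_halfspace_Im_gt) simp_all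
  then show "connected {\<zeta>. 0 < Im \<zeta> \<and> complex_of_real \<alpha> + \<zeta>\<^sup>2 \<notin> D}"
    by (simp add: g_def set_diff_eq)
qed

text \<open>At \<open>z = \<alpha> + \<zeta>\<^sup>2\<close> the two positivity conditions of a Stieltjes pair take this form, with
  \<open>a = \<langle>\<phi>x, \<psi>x\<rangle>\<close>.\<close>
lemma Im_cnj_mult_le_0:
  fixes \<zeta> a :: complex
  assumes "0 < Im \<zeta>" and "Re \<zeta> \<noteq> 0"
    and "Im (\<zeta>\<^sup>2) * Im a \<le> 0" and "Im (\<zeta>\<^sup>2) * Im (cnj (\<zeta>\<^sup>2) * a) \<le> 0"
  shows "Im (cnj \<zeta> * a) \<le> 0"
proof -
  have "4 * (Re \<zeta>)\<^sup>2 * Im \<zeta> * Im (cnj \<zeta> * a)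
      = Im (\<zeta>\<^sup>2) * Im (cnj (\<zeta>\<^sup>2) * a) + ((Re \<zeta>)\<^sup>2 + (Im \<zeta>)\<^sup>2) * (Im (\<zeta>\<^sup>2) * Im a)"
    by (simp add: power2_eq_square algebra_simps)
  also have "\<dots> \<le> 0"
    using assms(3,4) by (simp add: add_nonpos_nonpos mult_nonneg_nonpos)
  finally show ?thesis
    using assms(1,2) by (simp add: mult_le_0_iff)
qed

lemma nonpos_on_open_if_nonpos_off_imaginary_axis:
  fixes f :: "complex \<Rightarrow> real"
  assumes V: "open V" and f: "continuous_on V f" and "\<zeta> \<in> V"
    and nonpos: "\<And>\<xi>. \<xi> \<in> V \<Longrightarrow> Re \<xi> \<noteq> 0 \<Longrightarrow> f \<xi> \<le> 0"
  shows "f \<zeta> \<le> 0"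
proof -
  define X where "X n = \<zeta> + complex_of_real (inverse (real (Suc n)))" for n
  have "(\<lambda>n. complex_of_real (inverse (real (Suc n)))) \<longlonglongrightarrow> complex_of_real 0"
    by (rule tendsto_of_real[OF LIMSEQ_inverse_real_of_nat])
  then have X: "X \<longlonglongrightarrow> \<zeta>"
    unfolding X_def using tendsto_add[OF tendsto_const[of \<zeta>]] by fastforce
  have ev: "eventually (\<lambda>n. X n \<in> V) sequentially"
    by (rule topological_tendstoD[OF X V \<open>\<zeta> \<in> V\<close>])
  show ?thesis
  proof (cases "Re \<zeta> = 0")
    case True
    have "eventually (\<lambda>n. f (X n) \<le> 0) sequentially"
      using ev by (rule eventually_mono) (simp add: nonpos X_def True)
    then show ?thesis
      using tendsto_upperbound[OF continuous_on_tendsto_compose[OF f X \<open>\<zeta> \<in> V\<close> ev]] by simp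
  qed (rule nonpos[OF \<open>\<zeta> \<in> V\<close>])
qed

lemma stieltjes_pairE:
  fixes \<phi> \<psi> :: "complex \<Rightarrow> complex^'q::finite^'q"
  assumes "stieltjes_pair \<alpha> \<phi> \<psi>"
  obtains D where "discrete_subset D (slit_dom \<alpha>)"
    and "mat_holomorphic_on \<phi> (slit_dom \<alpha> - D)" and "mat_holomorphic_on \<psi> (slit_dom \<alpha> - D)"
    and "\<And>z x. z \<in> slit_dom \<alpha> - D \<Longrightarrow> \<phi> z *v x = 0 \<Longrightarrow> \<psi> z *v x = 0 \<Longrightarrow> x = 0"
    and "\<And>\<zeta> x. 0 < Im \<zeta> \<Longrightarrow> Re \<zeta> \<noteq> 0 \<Longrightarrow> complex_of_real \<alpha> + \<zeta>\<^sup>2 \<notin> D \<Longrightarrow>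
           Im (cnj \<zeta> * cinner (\<phi> (complex_of_real \<alpha> + \<zeta>\<^sup>2) *v x) (\<psi> (complex_of_real \<alpha> + \<zeta>\<^sup>2) *v x)) \<le> 0"
proof -
  obtain D where D: "discrete_subset D (slit_dom \<alpha>)"
    and hol: "mat_holomorphic_on \<phi> (slit_dom \<alpha> - D)" "mat_holomorphic_on \<psi> (slit_dom \<alpha> - D)"
    and rank: "\<And>z. z \<in> slit_dom \<alpha> - D \<Longrightarrow> rank (stack (\<phi> z) (\<psi> z)) = CARD('q)"
    and psd: "\<And>z. z \<notin> \<real> \<Longrightarrow> z \<notin> D \<Longrightarrow>
      psd (adj (stack (\<phi> z) (\<psi> z)) ** smat (- 1 / (2 * complex_of_real (Im z))) Jq
             ** stack (\<phi> z) (\<psi> z)) \<and>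
      psd (adj (stack (smat (z - complex_of_real \<alpha>) (\<phi> z)) (\<psi> z))
             ** smat (- 1 / (2 * complex_of_real (Im z))) Jq
             ** stack (smat (z - complex_of_real \<alpha>) (\<phi> z)) (\<psi> z))"
    using assms unfolding stieltjes_pair_def by blast
  show thesis
  proof (rule that[OF D hol])
    show "x = 0" if "z \<in> slit_dom \<alpha> - D" "\<phi> z *v x = 0" "\<psi> z *v x = 0" for z x
      using stack_full_rank_kernel[OF rank[OF that(1)] that(2,3)] .
    fix \<zeta> x
    assume \<zeta>: "0 < Im \<zeta>" "Re \<zeta> \<noteq> 0" and "complex_of_real \<alpha> + \<zeta>\<^sup>2 \<notin> D"
    let ?z = "complex_of_real \<alpha> + \<zeta>\<^sup>2"
    have "?z \<notin> \<real>"
      using \<zeta> by (simp add: complex_is_Real_iff power2_eq_square)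
    note psd_z = psd[OF this \<open>?z \<notin> D\<close>]
    have "Im ?z * Im (cinner (\<phi> ?z *v x) (\<psi> ?z *v x)) \<le> 0"
      using psd_Jq_stack_Im_le[OF conjunct1[OF psd_z]] .
    moreover have "Im ?z * Im (cnj (?z - complex_of_real \<alpha>) * cinner (\<phi> ?z *v x) (\<psi> ?z *v x)) \<le> 0"
      using psd_Jq_stack_Im_le[OF conjunct2[OF psd_z], of x] by (simp only: smat_mult_vector cinner_scale_left)
    ultimately show "Im (cnj \<zeta> * cinner (\<phi> ?z *v x) (\<psi> ?z *v x)) \<le> 0"
      using Im_cnj_mult_le_0[OF \<zeta>] by simp
  qed
qed

lemma stieltjes_pair_subspaces_const:
  fixes \<phi> \<psi> :: "complex \<Rightarrow> complex^'q::finite^'q"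
  assumes "stieltjes_pair \<alpha> \<phi> \<psi>"
  shows "\<exists>D. discrete_subset D (slit_dom \<alpha>) \<and>
           mat_holomorphic_on \<phi> (slit_dom \<alpha> - D) \<and> mat_holomorphic_on \<psi> (slit_dom \<alpha> - D) \<and>
           (\<forall>w \<in> slit_dom \<alpha> - D. \<forall>z \<in> slit_dom \<alpha> - D.
              pair_subspaces (\<phi> w) (\<psi> w) = pair_subspaces (\<phi> z) (\<psi> z))"
proof -
  obtain D where D: "discrete_subset D (slit_dom \<alpha>)"
    and hol: "mat_holomorphic_on \<phi> (slit_dom \<alpha> - D)" "mat_holomorphic_on \<psi> (slit_dom \<alpha> - D)"
    and ker: "\<And>z x. z \<in> slit_dom \<alpha> - D \<Longrightarrow> \<phi> z *v x = 0 \<Longrightarrow> \<psi> z *v x = 0 \<Longrightarrow> x = 0"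
    and Im_le: "\<And>\<zeta> x. 0 < Im \<zeta> \<Longrightarrow> Re \<zeta> \<noteq> 0 \<Longrightarrow> complex_of_real \<alpha> + \<zeta>\<^sup>2 \<notin> D \<Longrightarrow>
      Im (cnj \<zeta> * cinner (\<phi> (complex_of_real \<alpha> + \<zeta>\<^sup>2) *v x) (\<psi> (complex_of_real \<alpha> + \<zeta>\<^sup>2) *v x)) \<le> 0"
    using stieltjes_pairE[OF assms] by blast
  define g where "g \<zeta> = complex_of_real \<alpha> + \<zeta>\<^sup>2" for \<zeta>
  define V where "V = {\<zeta>. 0 < Im \<zeta> \<and> g \<zeta> \<notin> D}"
  have gV: "g ` V \<subseteq> slit_dom \<alpha> - D"
    using shifted_square_in_slit_dom by (auto simp: V_def g_def)
  have V: "open V" "connected V" "0 \<notin> V"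
    using open_connected_shifted_square_preimage[OF D] by (auto simp: V_def g_def)
  have "g holomorphic_on V"
    unfolding g_def[abs_def] by (intro holomorphic_intros)
  then have hol_V: "mat_holomorphic_on (\<lambda>\<zeta>. \<phi> (g \<zeta>)) V" "mat_holomorphic_on (\<lambda>\<zeta>. \<psi> (g \<zeta>)) V"
    using mat_holomorphic_on_compose[OF hol(1) _ gV] mat_holomorphic_on_compose[OF hol(2) _ gV] by blast+
  have "Im (cnj \<zeta> * cinner (\<phi> (g \<zeta>) *v x) (\<psi> (g \<zeta>) *v x)) \<le> 0" if "\<zeta> \<in> V" for \<zeta> x
  proof (rule nonpos_on_open_if_nonpos_off_imaginary_axis[OF V(1) _ that])
    show "continuous_on V (\<lambda>\<zeta>. Im (cnj \<zeta> * cinner (\<phi> (g \<zeta>) *v x) (\<psi> (g \<zeta>) *v x)))"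
      by (intro continuous_intros continuous_on_cinner_mult_vector hol_V)
    show "Im (cnj \<xi> * cinner (\<phi> (g \<xi>) *v x) (\<psi> (g \<xi>) *v x)) \<le> 0" if "\<xi> \<in> V" "Re \<xi> \<noteq> 0" for \<xi>
      using that Im_le unfolding V_def g_def by blast
  qed
  moreover have "x = 0" if "\<zeta> \<in> V" "\<phi> (g \<zeta>) *v x = 0" "\<psi> (g \<zeta>) *v x = 0" for \<zeta> x
    using gV that(1) by (intro ker[OF _ that(2,3)]) blast
  ultimately have const: "pair_subspaces (\<phi> (g \<zeta>)) (\<psi> (g \<zeta>)) = pair_subspaces (\<phi> (g \<xi>)) (\<psi> (g \<xi>))"
    if "\<zeta> \<in> V" "\<xi> \<in> V" for \<zeta> \<xi>
    using holomorphic_pair_subspaces_const[OF V hol_V _ _ that] by blast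
  have "pair_subspaces (\<phi> w) (\<psi> w) = pair_subspaces (\<phi> z) (\<psi> z)"
    if w: "w \<in> slit_dom \<alpha> - D" and z: "z \<in> slit_dom \<alpha> - D" for w z
  proof -
    obtain \<zeta> where "0 < Im \<zeta>" "g \<zeta> = w"
      using shifted_square_surj[OF DiffD1[OF w]] unfolding g_def by blast
    moreover obtain \<xi> where "0 < Im \<xi>" "g \<xi> = z"
      using shifted_square_surj[OF DiffD1[OF z]] unfolding g_def by blast
    ultimately show ?thesis
      using const[of \<zeta> \<xi>] w z by (simp add: V_def)
  qed
  with D hol show ?thesis
    by blast
qed

theorem proposition10p15:
  fixes \<alpha> :: real and \<phi> \<psi> :: "complex \<Rightarrow> complex^'q^'q"
  assumes "stieltjes_pair \<alpha> \<phi> \<psi>"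
  shows "\<exists>D. discrete_subset D (slit_dom \<alpha>) \<and>
           mat_holomorphic_on \<phi> (slit_dom \<alpha> - D) \<and> mat_holomorphic_on \<psi> (slit_dom \<alpha> - D) \<and>
           (\<forall>w \<in> slit_dom \<alpha> - D. \<forall>z \<in> slit_dom \<alpha> - D.
              range ((*v) (\<phi> w)) = range ((*v) (\<phi> z)) \<and>
              range ((*v) (\<psi> w)) = range ((*v) (\<psi> z)) \<and>
              (*v) (\<psi> w) ` {x. \<phi> w *v x = 0} = (*v) (\<psi> z) ` {x. \<phi> z *v x = 0} \<and>
              (*v) (\<phi> w) ` {x. \<psi> w *v x = 0} = (*v) (\<phi> z) ` {x. \<psi> z *v x = 0})"
  using stieltjes_pair_subspaces_const[OF assms] unfolding pair_subspaces_def prod.inject .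

end
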